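(* Let $d \geq 2$ be an integer and let $T$ be a tree of order $n$. Then $$\gamma_d^2(T) \leq \frac{n-2\sqrt{n}+d+1}{d}.$$
   Context: $\gamma_d^2(T)$ is the minimum size of a set $X\subseteq V(T)$ such that every vertex of $V(T)\setminus X$ is at distance at most $d$ from some vertex of $X$, and any two distinct vertices of $X$ are at distance at least $3$ in $T$. *)

theory Defs
  imports Complex_Main "Graph_Theory.Graph_Theory"
begin

text \<open>
  Undirected graphs are represented by symmetric digraphs (locale \<^locale>\<open>graph\<close>), in which
  traversing an edge back and forth is a \<^const>\<open>pre_digraph.cycle\<close> of length 2. The library
  constant \<^const>\<open>tree\<close> excludes such cycles as well, hence all edges; undirected
  acyclicity only forbids cycles of length at least 3.
\<close>

definition undirected_tree :: "('a, 'b) pre_digraph \<Rightarrow> bool" where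
  "undirected_tree T \<longleftrightarrow>
     graph T \<and> connected T \<and> \<not> (\<exists>p. pre_digraph.cycle T p \<and> 3 \<le> length p)"

definition graph_dist :: "('a, 'b) pre_digraph \<Rightarrow> 'a \<Rightarrow> 'a \<Rightarrow> ereal" where
  "graph_dist G u v = wf_digraph.\<mu> G (\<lambda>_. 1) u v"

definition distance_dominating :: "('a, 'b) pre_digraph \<Rightarrow> nat \<Rightarrow> 'a set \<Rightarrow> bool" where
  "distance_dominating G d X \<longleftrightarrow>
     X \<subseteq> verts G \<and> (\<forall>v \<in> verts G - X. \<exists>x \<in> X. graph_dist G v x \<le> ereal (real d))"

definition two_packing :: "('a, 'b) pre_digraph \<Rightarrow> 'a set \<Rightarrow> bool" where
  "two_packing G X \<longleftrightarrow>
     X \<subseteq> verts G \<and> (\<forall>x \<in> X. \<forall>y \<in> X. x \<noteq> y \<longrightarrow> 3 \<le> graph_dist G x y)"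

definition gamma2 :: "('a, 'b) pre_digraph \<Rightarrow> nat \<Rightarrow> nat" where
  "gamma2 G d = (LEAST k. \<exists>X. distance_dominating G d X \<and> two_packing G X \<and> card X = k)"

lemma awalk_cost_unit:
  fixes G :: "('a, 'b) pre_digraph" and p :: "'b list"
  assumes "wf_digraph G"
  shows "wf_digraph.awalk_cost (\<lambda>_. 1) p = real (length p)"
  by (induction p)
    (simp_all add: wf_digraph.awalk_cost_Nil[OF assms] wf_digraph.awalk_cost_Cons[OF assms])

lemma graph_dist_le_walk:
  assumes "wf_digraph G" "pre_digraph.awalk G u p v"
  shows "graph_dist G u v \<le> ereal (real (length p))"
  using wf_digraph.min_cost_le_walk_cost[OF assms, of "\<lambda>_. 1"]
  by (simp add: graph_dist_def awalk_cost_unit[OF assms(1)])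

lemma graph_dist_geI:
  assumes "wf_digraph G" "\<And>p. pre_digraph.awalk G u p v \<Longrightarrow> k \<le> length p"
  shows "ereal (real k) \<le> graph_dist G u v"
  unfolding graph_dist_def wf_digraph.\<mu>_def[OF assms(1)]
  by (rule INF_greatest) (use assms(2) in \<open>auto simp: awalk_cost_unit[OF assms(1)]\<close>)

lemma awalk_reverse:
  assumes "sym_digraph G" "pre_digraph.awalk G u p v"
  shows "\<exists>q. pre_digraph.awalk G v q u \<and> length q = length p"
proof -
  interpret sym_digraph G by fact
  show ?thesis using assms(2)
  proof (induction p arbitrary: u)
    case Nil
    then have "awalk v [] u" by (auto simp: awalk_Nil_iff)
    then show ?case by auto
  next
    case (Cons e p)
    then have e: "e \<in> arcs G" "u = tail G e" and w: "awalk (head G e) p v"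
      by (auto simp: awalk_Cons_iff)
    from Cons.IH[OF w] obtain q where q: "awalk v q (head G e)" "length q = length p" by auto
    have "(head G e, tail G e) \<in> arcs_ends G"
      using e(1) sym_arcs unfolding symmetric_def sym_def arcs_ends_def arc_to_ends_def
      by blast
    then obtain e' where e': "e' \<in> arcs G" "tail G e' = head G e" "head G e' = u"
      using e(2) by (auto simp: arcs_ends_def arc_to_ends_def)
    then have "awalk (head G e) [e'] u" by (auto simp: awalk_Cons_iff awalk_Nil_iff)
    with q have "awalk v (q @ [e']) u" by (auto simp: awalk_append_iff)
    then show ?case using q(2) by (intro exI[of _ "q @ [e']"]) auto
  qed
qed

text \<open>For \<open>d \<ge> 2\<close> a feasible set always exists, so the minimum in \<^const>\<open>gamma2\<close> is attained.\<close>

lemma gamma2_attained: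
  assumes "graph G" "2 \<le> d"
  shows "\<exists>X. distance_dominating G d X \<and> two_packing G X \<and> card X = gamma2 G d"
proof -
  interpret graph G by fact
  have sym: "sym_digraph G" and wf: "wf_digraph G" by unfold_locales
  define P where "P = {X. two_packing G X}"
  have "P \<subseteq> Pow (verts G)" by (auto simp: P_def two_packing_def)
  then have fin: "finite P" by (rule finite_subset) simp
  moreover have "{} \<in> P" by (simp add: P_def two_packing_def)
  ultimately have "Max (card ` P) \<in> card ` P" by (intro Max_in) auto
  then obtain X where X: "two_packing G X" "card X = Max (card ` P)"
    by (auto simp: P_def)
  have XV: "X \<subseteq> verts G" using X(1) by (simp add: two_packing_def)
  have finX: "finite X" using XV by (rule finite_subset) simp
  have "\<exists>x \<in> X. graph_dist G v x \<le> ereal (real d)" if v: "v \<in> verts G - X" for v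
  proof (rule ccontr)
    assume no: "\<not> ?thesis"
    have long: "3 \<le> length p" if "x \<in> X" "awalk v p x" for x p
    proof (rule ccontr)
      assume "\<not> ?thesis"
      then have "ereal (real (length p)) \<le> ereal (real d)" using assms(2) by simp
      with graph_dist_le_walk[OF wf that(2)] no that(1) show False
        by (meson order_trans)
    qed
    have "3 \<le> graph_dist G v x" "3 \<le> graph_dist G x v" if "x \<in> X" for x
      using graph_dist_geI[OF wf, of v x 3] graph_dist_geI[OF wf, of x v 3]
        long[OF that] awalk_reverse[OF sym, of x _ v]
      by (auto) (metis)
    then have "two_packing G (insert v X)"
      using X(1) v by (auto simp: two_packing_def)
    then have "card (insert v X) \<le> Max (card ` P)"
      using fin by (intro Max_ge) (auto simp: P_def)
    then show False using X(2) v finX by simp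
  qed
  then have "distance_dominating G d X" using XV by (auto simp: distance_dominating_def)
  then have "\<exists>k. \<exists>X. distance_dominating G d X \<and> two_packing G X \<and> card X = k"
    using X(1) by blast
  then show ?thesis unfolding gamma2_def by (rule LeastI_ex)
qed

end

theory Submission
  imports Defs
begin

text \<open>
  A tree with more than \<open>d\<close> vertices can be partitioned into subtrees (cells), each with more
  than \<open>d\<close> vertices and with a centre within distance \<open>d\<close> of all of its vertices. Let there be
  \<open>k\<close> cells and let \<open>w\<close> be the size of a largest one. Start with the centre of a largest cell
  and add the other cells one by one, each adjacent to the union of the previous ones. A new cell
  \<open>W\<close> with centre \<open>z\<close> is handled by \<open>z\<close> alone if \<open>z\<close> is at distance at least 3 from
  all chosen vertices. Otherwise only vertices of \<open>W\<close> on branches at \<open>z\<close> pointing away from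
  the chosen vertices can be uncovered, and it suffices to choose one vertex close to \<open>z\<close> on
  each such branch of depth \<open>d\<close> (or a single neighbour of \<open>z\<close>). As each deep branch has at
  least \<open>d\<close> vertices, at most \<open>(|W| - 1) / d\<close> vertices are added. Altogether
  \<open>d (|X| - 1) \<le> n - w - (k - 1)\<close>, and \<open>n \<le> k w\<close> gives \<open>k + w \<ge> 2 sqrt n\<close>.
\<close>

section \<open>Metrics of finite trees\<close>

text \<open>The tree is replaced by its distance function, so that paths never have to be handled.
  Acyclicity survives as \<open>no_backtrack\<close>: if one neighbour of \<open>z\<close> leads
  towards \<open>v\<close>, every other neighbour of \<open>z\<close> leads away from
  \<open>v\<close>.\<close>

locale tree_metric =
  fixes V :: "'a set" and D :: "'a \<Rightarrow> 'a \<Rightarrow> nat"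
  assumes finite_V: "finite V"
    and dist_eq_0: "a \<in> V \<Longrightarrow> b \<in> V \<Longrightarrow> D a b = 0 \<longleftrightarrow> a = b"
    and dist_commute: "D a b = D b a"
    and triangle: "a \<in> V \<Longrightarrow> b \<in> V \<Longrightarrow> c \<in> V \<Longrightarrow> D a c \<le> D a b + D b c"
    and step: "a \<in> V \<Longrightarrow> b \<in> V \<Longrightarrow> a \<noteq> b \<Longrightarrow> \<exists>c\<in>V. D a c = 1 \<and> D a b = Suc (D c b)"
    and no_backtrack: "v \<in> V \<Longrightarrow> z \<in> V \<Longrightarrow> c \<in> V \<Longrightarrow> c' \<in> V \<Longrightarrow> c \<noteq> c' \<Longrightarrow>
      D z c = 1 \<Longrightarrow> D z c' = 1 \<Longrightarrow> D v z = Suc (D v c) \<Longrightarrow> D v c' = Suc (D v z)"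
begin

text \<open>Geodesic convexity. In a tree these are the vertex sets of subtrees, together with the
  empty set, so this expresses connectedness through distances alone.\<close>

definition dconvex :: "'a set \<Rightarrow> bool" where
  "dconvex S \<longleftrightarrow> S \<subseteq> V \<and> (\<forall>a\<in>S. \<forall>b\<in>S. \<forall>c\<in>V. D a c + D c b = D a b \<longrightarrow> c \<in> S)"

text \<open>For adjacent \<open>z\<close> and \<open>c\<close>: the component of \<open>c\<close> after deleting the edge \<open>zc\<close>.\<close>

definition branch :: "'a \<Rightarrow> 'a \<Rightarrow> 'a set" where
  "branch z c = {v \<in> V. D z v = Suc (D c v)}"

definition packing :: "'a set \<Rightarrow> bool" where
  "packing X \<longleftrightarrow> (\<forall>x\<in>X. \<forall>y\<in>X. x \<noteq> y \<longrightarrow> 3 \<le> D x y)"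

definition covers :: "nat \<Rightarrow> 'a set \<Rightarrow> 'a set \<Rightarrow> bool" where
  "covers d X S \<longleftrightarrow> (\<forall>v\<in>S. \<exists>x\<in>X. D v x \<le> d)"

definition cell :: "nat \<Rightarrow> 'a set \<Rightarrow> bool" where
  "cell d W \<longleftrightarrow> dconvex W \<and> (\<exists>z\<in>W. \<forall>w\<in>W. D z w \<le> d) \<and> d < card W"

lemma dconvexD:
  assumes "dconvex S" "a \<in> S" "b \<in> S" "c \<in> V" "D a c + D c b = D a b"
  shows "c \<in> S"
proof -
  have "\<forall>a\<in>S. \<forall>b\<in>S. \<forall>c\<in>V. D a c + D c b = D a b \<longrightarrow> c \<in> S"
    using assms(1) unfolding dconvex_def by (rule conjunct2)
  from this[rule_format, OF assms(2-5)] show ?thesis .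
qed

lemma dconvex_subset: "dconvex S \<Longrightarrow> S \<subseteq> V"
  unfolding dconvex_def by blast

lemma dist_self [simp]: "a \<in> V \<Longrightarrow> D a a = 0"
  using dist_eq_0 by simp

section \<open>Branches and distances between them\<close>

lemma not_in_own_branch: "z \<in> V \<Longrightarrow> z \<notin> branch z c"
  by (simp add: branch_def)

text \<open>Trees are bipartite. If the distances agreed, the next vertex \<open>e\<close> from
  \<open>z\<close> towards \<open>v\<close> would differ from \<open>c\<close>, and
  \<open>no_backtrack\<close> would put \<open>c\<close> farther from \<open>v\<close> than
  \<open>z\<close>.\<close>

lemma adjacent_dist_neq:
  assumes "z \<in> V" "c \<in> V" "D z c = 1" "v \<in> V"
  shows "D z v \<noteq> D c v"
proof
  assume eq: "D z v = D c v"
  have "z \<noteq> v" using eq assms by (auto simp: dist_commute)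
  then obtain e where e: "e \<in> V" "D z e = 1" "D z v = Suc (D e v)"
    using step assms by blast
  moreover have "e \<noteq> c" using e eq by auto
  ultimately have "D v c = Suc (D v z)"
    using no_backtrack[of v z e c] assms eq by (auto simp: dist_commute)
  then show False using eq by (simp add: dist_commute)
qed

lemma branch_compl:
  assumes "z \<in> V" "c \<in> V" "D z c = 1" "v \<in> V"
  shows "v \<in> branch z c \<longleftrightarrow> v \<notin> branch c z"
proof -
  have "D z v \<le> Suc (D c v)" "D c v \<le> Suc (D z v)"
    using triangle[of z c v] triangle[of c z v] assms dist_commute[of c z] by simp_all
  then have "D z v = Suc (D c v) \<or> D c v = Suc (D z v)"
    using adjacent_dist_neq[OF assms] by linarith
  then show ?thesis using assms(4) unfolding branch_def by (elim disjE) simp_all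
qed

lemma first_step:
  assumes "z \<in> V" "v \<in> V" "z \<noteq> v"
  shows "\<exists>c\<in>V. D z c = 1 \<and> v \<in> branch z c"
  using step[OF assms] assms(2) unfolding branch_def by blast

text \<open>The induction moves the base vertex from \<open>z\<close> to \<open>c'\<close>: seen
  from there, \<open>x\<close> lies on the branch through \<open>z\<close>, while \<open>w\<close>
  lies on the branch of the next vertex \<open>e\<close> towards \<open>w\<close>.\<close>

lemma dist_through:
  assumes "z \<in> V" "c \<in> V" "c' \<in> V" "c \<noteq> c'" "D z c = 1" "D z c' = 1"
    and "x \<in> branch z c" "w \<in> branch z c'"
  shows "D x w = D x z + D z w"
  using assms
proof (induction "D c' w" arbitrary: z c c')
  case 0
  then have "w = c'" by (auto simp: branch_def dist_eq_0)
  moreover have "D x c' = Suc (D x z)"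
    using no_backtrack[of x z c c'] 0 by (auto simp: branch_def dist_commute)
  ultimately show ?case using 0 by simp
next
  case (Suc k)
  have V: "x \<in> V" "w \<in> V" using Suc by (auto simp: branch_def)
  have *: "D x c' = Suc (D x z)"
    using no_backtrack[of x z c c'] Suc by (auto simp: branch_def dist_commute)
  have "c' \<noteq> w" using Suc V by auto
  then obtain e where e: "e \<in> V" "D c' e = 1" "w \<in> branch c' e"
    using first_step[of c' w] Suc V by blast
  have "z \<noteq> e" using e Suc by (auto simp: branch_def)
  have "D x w = D x c' + D c' w"
    using Suc(1)[of e c' z] e * Suc V \<open>z \<noteq> e\<close> by (auto simp: branch_def dist_commute)
  then show ?case using * Suc by (auto simp: branch_def)
qed

lemma dist_across_edge:
  assumes "u \<in> V" "v \<in> V" "D u v = 1" "a \<in> branch v u" "b \<in> branch u v"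
  shows "D a b = D a u + Suc (D v b)"
proof (cases "a = u")
  case True
  then show ?thesis using assms by (simp add: branch_def)
next
  case False
  have V: "a \<in> V" using assms by (simp add: branch_def)
  then obtain c where c: "c \<in> V" "D u c = 1" "a \<in> branch u c"
    using first_step[of u a] False assms by blast
  have "c \<noteq> v" using c assms by (auto simp: branch_def)
  then have "D a b = D a u + D u b" using dist_through[of u c v a b] c assms by auto
  then show ?thesis using assms by (simp add: branch_def)
qed

lemma branches_disjoint:
  assumes "z \<in> V" "c \<in> V" "c' \<in> V" "c \<noteq> c'" "D z c = 1" "D z c' = 1"
  shows "branch z c \<inter> branch z c' = {}"
proof (rule ccontr)
  assume "\<not> ?thesis"
  then obtain w where w: "w \<in> branch z c" "w \<in> branch z c'" by blast
  then have "D w w = D w z + D z w" using dist_through[of z c c' w w] assms by blast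
  moreover have "w \<in> V" using w by (simp add: branch_def)
  ultimately show False using w by (simp add: branch_def)
qed

section \<open>Geodesics and convex sets\<close>

lemma geodesic_point:
  assumes "a \<in> V" "b \<in> V" "j \<le> D a b"
  shows "\<exists>c\<in>V. D a c = j \<and> D c b = D a b - j"
  using assms(3)
proof (induction j)
  case 0
  then show ?case using assms by (intro bexI[of _ a]) auto
next
  case (Suc j)
  then obtain c where c: "c \<in> V" "D a c = j" "D c b = D a b - j" by auto
  then have "c \<noteq> b" using Suc assms by auto
  then obtain e where e: "e \<in> V" "D c e = 1" "D c b = Suc (D e b)"
    using step c assms by blast
  have "D a e \<le> Suc j" "D a b \<le> D a e + D e b"
    using triangle[of a c e] triangle[of a e b] c e assms by auto
  then show ?case using c e Suc by (intro bexI[of _ e]) auto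
qed

text \<open>A geodesic from \<open>a\<close> to \<open>b\<close> stays in \<open>S\<close>, and its
  \<open>D a b + 1\<close> vertices have distinct distances from \<open>a\<close>.\<close>

lemma dist_less_card_dconvex:
  assumes "dconvex S" "a \<in> S" "b \<in> S"
  shows "D a b < card S"
proof -
  have S: "S \<subseteq> V" using assms(1) by (rule dconvex_subset)
  then have fin: "finite S" using finite_V by (rule finite_subset)
  have "{..D a b} \<subseteq> D a ` S"
  proof
    fix j assume "j \<in> {..D a b}"
    then obtain c where c: "c \<in> V" "D a c = j" "D c b = D a b - j" "j \<le> D a b"
      using geodesic_point[of a b j] assms S by auto
    then have "c \<in> S" using dconvexD[of S a b c] assms by auto
    then show "j \<in> D a ` S" using c by auto
  qed
  then have "card {..D a b} \<le> card (D a ` S)" using fin by (intro card_mono) auto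
  also have "\<dots> \<le> card S" using fin by (rule card_image_le)
  finally show ?thesis by simp
qed

lemma dconvex_V: "dconvex V"
  by (simp add: dconvex_def)

lemma dconvex_Int:
  assumes "dconvex S" "dconvex S'"
  shows "dconvex (S \<inter> S')"
  unfolding dconvex_def[of "S \<inter> S'"]
proof (intro conjI ballI impI)
  show "S \<inter> S' \<subseteq> V" using dconvex_subset[OF assms(1)] by blast
  fix a b c assume "a \<in> S \<inter> S'" "b \<in> S \<inter> S'" "c \<in> V" "D a c + D c b = D a b"
  then show "c \<in> S \<inter> S'" using dconvexD[OF assms(1), of a b c] dconvexD[OF assms(2), of a b c] by simp
qed

text \<open>A geodesic that left the branch and came back would cross the edge \<open>uv\<close>
  twice, which is longer than the route through \<open>v\<close>.\<close>

lemma dconvex_branch: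
  assumes "u \<in> V" "v \<in> V" "D u v = 1"
  shows "dconvex (branch u v)"
  unfolding dconvex_def
proof (intro conjI ballI impI)
  show "branch u v \<subseteq> V" by (auto simp: branch_def)
  fix a b c assume ab: "a \<in> branch u v" "b \<in> branch u v" and c: "c \<in> V" "D a c + D c b = D a b"
  show "c \<in> branch u v"
  proof (rule ccontr)
    assume "c \<notin> branch u v"
    then have "c \<in> branch v u" using branch_compl[of u v c] assms c by auto
    then have "D c a = D c u + Suc (D v a)" "D c b = D c u + Suc (D v b)"
      using dist_across_edge[of u v c] assms ab by auto
    moreover have "D a b \<le> D a v + D v b" using triangle[of a v b] ab assms by (auto simp: branch_def)
    ultimately show False using c by (simp add: dist_commute)
  qed
qed

text \<open>Each set lies on its own side of the edge \<open>uv\<close>: a point of \<open>U\<close>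
  beyond the edge would put \<open>v\<close> on a geodesic inside \<open>U\<close>, and likewise for
  \<open>W\<close> and \<open>u\<close>. A geodesic from \<open>U\<close> to \<open>W\<close>
  therefore splits at the edge into a part in \<open>U\<close> and a part in
  \<open>W\<close>.\<close>

lemma dconvex_Un_adjacent:
  assumes "dconvex U" "dconvex W" "U \<inter> W = {}" "u \<in> U" "v \<in> W" "D u v = 1"
  shows "dconvex (U \<union> W)"
proof -
  have sub: "U \<subseteq> V" "W \<subseteq> V" using assms(1,2) dconvex_subset by auto
  have uv: "u \<in> V" "v \<in> V" "D v u = 1" using assms sub by (auto simp: dist_commute)
  have U: "a \<in> branch v u" if "a \<in> U" for a
  proof (rule ccontr)
    assume "a \<notin> branch v u"
    then have "a \<in> branch u v" using branch_compl[of u v a] that sub uv assms by auto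
    then have "v \<in> U" using dconvexD[of U u a v] assms that uv by (auto simp: branch_def)
    then show False using assms by auto
  qed
  have W: "a \<in> branch u v" if "a \<in> W" for a
  proof (rule ccontr)
    assume "a \<notin> branch u v"
    then have "a \<in> branch v u" using branch_compl[of u v a] that sub uv assms by auto
    then have "u \<in> W" using dconvexD[of W v a u] assms that uv by (auto simp: branch_def)
    then show False using assms by auto
  qed
  have cross: "c \<in> U \<union> W" if "a \<in> U" "b \<in> W" "c \<in> V" "D a c + D c b = D a b" for a b c
  proof -
    have ab: "D a b = D a u + Suc (D v b)"
      using dist_across_edge[of u v a b] U W that uv assms by auto
    show ?thesis
    proof (cases "c \<in> branch u v")
      case True
      then have "D a c = D a u + Suc (D v c)"
        using dist_across_edge[of u v a c] U that uv assms by auto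
      then have "c \<in> W" using dconvexD[of W v b c] ab that assms by auto
      then show ?thesis by simp
    next
      case False
      then have "c \<in> branch v u" using branch_compl[of u v c] that uv assms by auto
      then have "D c b = D c u + Suc (D v b)"
        using dist_across_edge[of u v c b] W that uv assms by auto
      then have "c \<in> U" using dconvexD[of U a u c] ab that assms by auto
      then show ?thesis by simp
    qed
  qed
  show ?thesis unfolding dconvex_def
  proof (intro conjI ballI impI)
    show "U \<union> W \<subseteq> V" using sub by auto
    fix a b c assume h: "a \<in> U \<union> W" "b \<in> U \<union> W" "c \<in> V" "D a c + D c b = D a b"
    have h': "D b c + D c a = D b a" using h(4) by (simp add: dist_commute)
    from h(1,2) consider "a \<in> U" "b \<in> U" | "a \<in> W" "b \<in> W" | "a \<in> U" "b \<in> W" | "a \<in> W" "b \<in> U"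
      by blast
    then show "c \<in> U \<union> W"
      by cases (use dconvexD assms(1,2) h(3,4) h' cross in blast)+
  qed
qed

lemma exists_boundary_edge:
  assumes "U \<subseteq> V" "u \<in> U" "v \<in> V - U"
  shows "\<exists>a\<in>U. \<exists>b\<in>V - U. D a b = 1"
  using assms(2)
proof (induction "D u v" arbitrary: u rule: less_induct)
  case less
  have "u \<noteq> v" using less assms by auto
  then obtain c where c: "c \<in> V" "D u c = 1" "D u v = Suc (D c v)"
    using step[of u v] less assms by auto
  show ?case
  proof (cases "c \<in> U")
    case True
    then show ?thesis using less(1)[of c] c by simp
  next
    case False
    then show ?thesis using c less by blast
  qed
qed

section \<open>Decomposition into cells\<close>

text \<open>Root \<open>S\<close> at \<open>r\<close> and cut it at the vertex \<open>y\<close>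
  lying \<open>d\<close> steps above a deepest vertex \<open>w\<close>. The part \<open>A\<close>
  below \<open>y\<close> stays within distance \<open>d\<close> of \<open>y\<close> because
  \<open>w\<close> is deepest, and it contains the \<open>d + 1\<close> vertices between
  \<open>y\<close> and \<open>w\<close>, so it is a cell. The rest \<open>C\<close> is left to the
  induction if it is large enough.\<close>

lemma partition_into_cells:
  assumes "dconvex S" "d < card S"
  shows "\<exists>P. \<Union>P = S \<and> pairwise disjnt P \<and> (\<forall>W\<in>P. cell d W)"
  using assms
proof (induction "card S" arbitrary: S rule: less_induct)
  case less
  have S: "S \<subseteq> V" using less(2) by (rule dconvex_subset)
  have fin: "finite S" using S finite_V by (rule finite_subset)
  have single: ?case if "z \<in> S" "\<forall>w\<in>S. D z w \<le> d" for z
    using that less(2,3) by (intro exI[of _ "{S}"]) (auto simp: cell_def)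
  obtain r where r: "r \<in> S" using less(3) by fastforce
  show ?case
  proof (cases "\<forall>w\<in>S. D r w \<le> d")
    case True
    then show ?thesis using single r by blast
  next
    case False
    define m where "m = Max (D r ` S)"
    have "m \<in> D r ` S" unfolding m_def using fin r by (intro Max_in) auto
    then obtain w where w: "w \<in> S" "D r w = m" by auto
    have max: "D r v \<le> m" if "v \<in> S" for v unfolding m_def using fin that by simp
    have "d < m" using False max by (meson le_less_trans not_le)
    then obtain y where y: "y \<in> V" "D r y = m - d" "D y w = d"
      using geodesic_point[of r w "m - d"] w r S by auto
    have yS: "y \<in> S" using dconvexD[of S r w y] less(2) r w y \<open>d < m\<close> by auto
    have "y \<noteq> r" using y \<open>d < m\<close> r S by auto
    then obtain b where b: "b \<in> V" "D y b = 1" "r \<in> branch y b"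
      using first_step[of y r] y r S by auto
    have by1: "D b y = 1" using b by (simp add: dist_commute)
    have bS: "b \<in> S" using dconvexD[of S y r b] b yS r less(2) by (auto simp: branch_def)
    define A where "A = S \<inter> branch b y"
    define C where "C = S \<inter> branch y b"
    have cA: "dconvex A" and cC: "dconvex C"
      unfolding A_def C_def using dconvex_Int dconvex_branch less(2) b y by1 by auto
    have AC: "A \<union> C = S" "A \<inter> C = {}"
      using branch_compl[of y b] y b S by (auto simp: A_def C_def)
    have yA: "y \<in> A" using yS b y by1 by (simp add: A_def branch_def)
    have bC: "b \<in> C" using bS b by (simp add: C_def branch_def)
    have finAC: "finite A" "finite C" using fin by (auto simp: A_def C_def)
    have ry: "D r v = D r y + D y v" if "v \<in> A" for v
      using dist_across_edge[of b y r v] that b y by1 dist_commute[of r]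
      by (simp add: A_def branch_def)
    have Ad: "D y v \<le> d" if "v \<in> A" for v
      using ry[OF that] max[of v] that y \<open>d < m\<close> by (simp add: A_def)
    \<comment> \<open>Otherwise the neighbour \<open>b\<close> of \<open>y\<close> would be one step
      closer than \<open>y\<close> to both \<open>r\<close> and \<open>w\<close>, and
      \<open>w\<close> would have depth at most \<open>m - 2\<close>.\<close>
    have wA: "w \<in> A"
    proof (rule ccontr)
      assume "w \<notin> A"
      then have "w \<in> branch y b" using AC w by (auto simp: C_def)
      then have "Suc (D b w) = d" "Suc (D r b) = m - d"
        using y b dist_commute[of r] by (auto simp: branch_def)
      moreover have "m \<le> D r b + D b w" using triangle[of r b w] w r b S by auto
      ultimately show False by simp
    qed
    have cardA: "d < card A" using dist_less_card_dconvex[OF cA yA wA] y by simp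
    show ?thesis
    proof (cases "d < card C")
      case True
      have "card C < card S" using AC yA fin by (intro psubset_card_mono) auto
      then obtain P where P: "\<Union>P = C" "pairwise disjnt P" "\<forall>W\<in>P. cell d W"
        using less(1)[of C] cC True by blast
      have "cell d A" using cA yA Ad cardA by (auto simp: cell_def)
      moreover have "pairwise disjnt (insert A P)"
        using P AC by (auto simp: pairwise_insert disjnt_def)
      ultimately show ?thesis using P AC by (intro exI[of _ "insert A P"]) auto
    next
      case False
      \<comment> \<open>The remainder is too small to reach beyond distance \<open>d\<close> from \<open>y\<close>.\<close>
      have "D y v \<le> d" if "v \<in> S" for v
      proof (cases "v \<in> A")
        case False
        then have v: "v \<in> C" using that AC by auto
        then have "D b v < card C" using dist_less_card_dconvex[OF cC bC] by simp
        then show ?thesis using v \<open>\<not> d < card C\<close> by (simp add: C_def branch_def)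
      qed (rule Ad)
      then show ?thesis by (intro single[OF yS] ballI)
    qed
  qed
qed

section \<open>Adding one cell\<close>

text \<open>If two vertices of \<open>U\<close> lay on different branches at \<open>z\<close>, their
  geodesic would pass through \<open>z\<close>, and convexity would put \<open>z\<close> into
  \<open>U\<close>.\<close>

lemma common_first_step:
  assumes "dconvex U" "U \<noteq> {}" "z \<in> V - U"
  shows "\<exists>b\<in>V. D z b = 1 \<and> U \<subseteq> branch z b"
proof -
  have UV: "U \<subseteq> V" using assms(1) by (rule dconvex_subset)
  obtain x where x: "x \<in> U" using assms by auto
  then have "z \<in> V" "x \<in> V" "z \<noteq> x" using UV assms(3) by auto
  then obtain b where b: "b \<in> V" "D z b = 1" "x \<in> branch z b"
    using first_step[of z x] by blast
  have "y \<in> branch z b" if yU: "y \<in> U" for y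
  proof (rule ccontr)
    assume n: "y \<notin> branch z b"
    have "z \<in> V" "y \<in> V" "z \<noteq> y" using UV assms(3) yU by auto
    then obtain c where c: "c \<in> V" "D z c = 1" "y \<in> branch z c"
      using first_step[of z y] by blast
    then have "D x y = D x z + D z y"
      using dist_through[of z b c x y] b n assms by auto
    then show False using dconvexD[of U x y z] assms x yU by auto
  qed
  then show ?thesis using b by auto
qed

text \<open>By convexity each of these branches has vertices of \<open>W\<close> at all distances
  \<open>1..d\<close> from \<open>z\<close>. The branches are disjoint and miss \<open>z\<close>,
  whence the \<open>- 1\<close>.\<close>

lemma deep_branches_card:
  assumes "dconvex W" "z \<in> W" "1 \<le> d"
    and B: "\<And>c. c \<in> B \<Longrightarrow> c \<in> V \<and> D z c = 1 \<and> (\<exists>w\<in>W. D z w = d \<and> w \<in> branch z c)"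
  shows "d * card B \<le> card W - 1"
proof -
  have WV: "W \<subseteq> V" using assms(1) by (rule dconvex_subset)
  have fin: "finite W" using WV finite_V by (rule finite_subset)
  have finB: "finite B" using B finite_V by (meson finite_subset subsetI)
  have zV: "z \<in> V" using assms WV by auto
  have big: "d \<le> card (W \<inter> branch z c)" if cB: "c \<in> B" for c
  proof -
    obtain w where w: "c \<in> V" "D z c = 1" "w \<in> W" "D z w = d" "w \<in> branch z c"
      using B[OF cB] by blast
    have "{1..d} \<subseteq> D z ` (W \<inter> branch z c)"
    proof
      fix j assume j: "j \<in> {1..d}"
      have "D z w = Suc (D c w)" "w \<in> V" using w(5) by (auto simp: branch_def)
      then have "j - 1 \<le> D c w" "w \<in> V" using j w(4) by auto
      then obtain v where v: "v \<in> V" "D c v = j - 1" "D v w = D c w - (j - 1)"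
        using geodesic_point[of c w "j - 1"] w(1) by blast
      have "D z v \<le> 1 + D c v" "D z w \<le> D z v + D v w"
        using triangle[of z c v] triangle[of z v w] v w zV WV by auto
      then have "D z v = j" "D z v + D v w = D z w" "v \<in> branch z c"
        using j v w by (auto simp: branch_def)
      then show "j \<in> D z ` (W \<inter> branch z c)"
        using dconvexD[of W z w v] assms v w by auto
    qed
    then have "card {1..d} \<le> card (D z ` (W \<inter> branch z c))" using fin by (intro card_mono) auto
    also have "\<dots> \<le> card (W \<inter> branch z c)" using fin by (intro card_image_le) auto
    finally show ?thesis by simp
  qed
  have "d * card B = (\<Sum>c\<in>B. d)" by simp
  also have "\<dots> \<le> (\<Sum>c\<in>B. card (W \<inter> branch z c))" using big by (intro sum_mono)
  also have "\<dots> = card (\<Union>c\<in>B. W \<inter> branch z c)"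
    using finB fin branches_disjoint[OF zV] B by (subst card_UN_disjoint) blast+
  also have "\<dots> \<le> card (W - {z})"
    using fin not_in_own_branch[OF zV] by (intro card_mono) auto
  also have "\<dots> = card W - 1" using assms fin by simp
  finally show ?thesis .
qed

lemma packing_Un:
  assumes "packing X" "packing Y" "\<And>x y. x \<in> X \<Longrightarrow> y \<in> Y \<Longrightarrow> 3 \<le> D y x"
  shows "packing (X \<union> Y)"
  unfolding packing_def
proof (intro ballI impI)
  fix x y assume "x \<in> X \<union> Y" "y \<in> X \<union> Y" "x \<noteq> y"
  then show "3 \<le> D x y"
    using assms(1,2) assms(3)[of x y] assms(3)[of y x] dist_commute[of x y]
    unfolding packing_def by auto
qed

text \<open>Suppose \<open>X\<close> comes within distance 2 of the centre \<open>z\<close>. If it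
  comes within distance 1, all uncovered vertices have depth exactly \<open>d\<close>, and the
  second vertex of each deep branch suffices. Otherwise a neighbour \<open>c0\<close> of
  \<open>z\<close> may be chosen: it covers everything of depth below \<open>d\<close> and its own
  branch, and second vertices serve the other deep branches.\<close>

lemma extend_by_cell:
  assumes d: "2 \<le> d" and U: "dconvex U" and W: "cell d W" and disj: "U \<inter> W = {}"
    and X: "X \<subseteq> U" "packing X"
  shows "\<exists>Y\<subseteq>W. d * card Y \<le> card W - 1 \<and> packing (X \<union> Y) \<and> covers d (X \<union> Y) W"
proof -
  obtain z where z: "z \<in> W" "\<And>w. w \<in> W \<Longrightarrow> D z w \<le> d" and cW: "dconvex W" and dW: "d < card W"
    using W by (auto simp: cell_def)
  have UV: "U \<subseteq> V" and WV: "W \<subseteq> V" using U cW dconvex_subset by auto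
  have zV: "z \<in> V" using z WV by auto
  show ?thesis
  proof (cases "\<forall>x\<in>X. 3 \<le> D z x")
    case True
    then have "packing (X \<union> {z})" using X by (intro packing_Un) (auto simp: packing_def)
    moreover have "covers d (X \<union> {z}) W" using z by (auto simp: covers_def dist_commute)
    ultimately show ?thesis using z dW by (intro exI[of _ "{z}"]) auto
  next
    case False
    then obtain x where x: "x \<in> X" "D z x \<le> 2" by fastforce
    have xV: "x \<in> V" using x X UV by auto
    obtain b where b: "b \<in> V" "D z b = 1" "U \<subseteq> branch z b"
      using common_first_step[of U z] U x X z zV disj by auto
    define R where "R = {w \<in> W. \<forall>x\<in>X. d < D w x}"
    \<comment> \<open>Both \<open>w\<close> and \<open>x\<close> would be one step closer to
      \<open>b\<close> than to \<open>z\<close>, so \<open>D w x\<close> would be at most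
      \<open>d + 2 - 2\<close>.\<close>
    have Rb: "w \<notin> branch z b" if "w \<in> R" for w
    proof
      assume w: "w \<in> branch z b"
      have "D w x \<le> D w b + D b x" using triangle[of w b x] w b xV by (auto simp: branch_def)
      moreover have "D z w \<le> d" "d < D w x" using that z x by (auto simp: R_def)
      moreover have "D z x = Suc (D b x)" using b x X by (auto simp: branch_def)
      ultimately show False using w x dist_commute[of w b] by (simp add: branch_def)
    qed
    have Rd: "d < D z w + D z x" if "w \<in> R" for w
      using that triangle[of w z x] x xV zV WV dist_commute[of w z]
      by (fastforce simp: R_def)
    have Rz: "w \<noteq> z" if "w \<in> R" for w using Rd[OF that] x d zV by auto
    have "R \<subseteq> V" using WV by (auto simp: R_def)
    then have "\<forall>w. \<exists>c. w \<in> R \<longrightarrow> c \<in> V \<and> D z c = 1 \<and> w \<in> branch z c"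
      using first_step[of z] Rz zV by (metis subsetD)
    then obtain f where f: "\<And>w. w \<in> R \<Longrightarrow> f w \<in> V \<and> D z (f w) = 1 \<and> w \<in> branch z (f w)"
      by metis
    have fb: "f w \<noteq> b" if "w \<in> R" for w using f Rb that by metis
    have fW: "f w \<in> W" if "w \<in> R" for w
      using dconvexD[of W z w "f w"] f[OF that] cW z that by (auto simp: R_def branch_def)
    \<comment> \<open>The first vertices of the deep branches that still contain an uncovered vertex
      of depth \<open>d\<close>.\<close>
    define B where "B = f ` {w \<in> R. D z w = d}"
    have cardB: "d * card B \<le> card W - 1"
      using d f by (intro deep_branches_card[OF cW z(1)]) (auto simp: B_def R_def)
    have finB: "finite B"
      unfolding B_def R_def using finite_subset[OF WV finite_V] by simp
    have Bc: "c \<in> V" "D z c = 1" "c \<noteq> b" if "c \<in> B" for c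
      using that f fb by (auto simp: B_def)
    \<comment> \<open>The second vertex on a deep branch still covers that whole branch and is at distance at
      least 3 from everything outside \<open>W\<close> and from the other branches' choices.\<close>
    have "\<forall>c. \<exists>e. c \<in> B \<longrightarrow> e \<in> W \<and> D c e = 1 \<and> D z e = 2"
    proof (intro allI)
      fix c show "\<exists>e. c \<in> B \<longrightarrow> e \<in> W \<and> D c e = 1 \<and> D z e = 2"
      proof (cases "c \<in> B")
        case True
        then obtain w where w: "w \<in> R" "D z w = d" "c = f w" by (auto simp: B_def)
        then have c: "c \<in> V" "D z c = 1" "Suc (D c w) = d" and wW: "w \<in> W"
          using f[OF w(1)] by (auto simp: branch_def R_def)
        have "c \<noteq> w" using c d by auto
        then obtain e where e: "e \<in> V" "D c e = 1" "D c w = Suc (D e w)"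
          using step[of c w] c wW WV by blast
        have "D z e \<le> 2" "d \<le> D z e + D e w"
          using triangle[of z c e] triangle[of z e w] c e w wW WV zV by auto
        then have "D z e = 2" "D z e + D e w = D z w" using c e w by auto
        then show ?thesis using dconvexD[of W z w e] cW z wW e by blast
      qed simp
    qed
    then obtain g where g: "\<And>c. c \<in> B \<Longrightarrow> g c \<in> W \<and> D c (g c) = 1 \<and> D z (g c) = 2"
      by metis
    have gbr: "g c \<in> branch z c" if "c \<in> B" for c
      using g[OF that] WV by (auto simp: branch_def)
    have away: "D v y = D v z + D z y"
      if "v \<in> branch z c" "c \<in> V" "D z c = 1" "c \<noteq> b" "y \<in> X" for v c y
      using dist_through[of z c b v y] that b zV X by blast
    \<comment> \<open>The geodesic passes through \<open>z\<close>, which is 2 away from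
      \<open>g c\<close> and at least 1 away from \<open>X\<close>.\<close>
    have gX: "3 \<le> D (g c) y" if "c \<in> B" "y \<in> X" for c y
    proof -
      have "z \<noteq> y" "y \<in> V" using that X UV disj z by auto
      then have "1 \<le> D z y" using dist_eq_0[of z y] zV by simp
      then show ?thesis using away[OF gbr] that Bc g dist_commute[of "g c" z] by force
    qed
    have gg: "packing (g ` B')" if sub: "B' \<subseteq> B" for B'
      unfolding packing_def
    proof (intro ballI impI)
      fix u v assume uv: "u \<in> g ` B'" "v \<in> g ` B'" "u \<noteq> v"
      then obtain c c' where cc: "c \<in> B" "c' \<in> B" "u = g c" "v = g c'" "c \<noteq> c'"
        using sub by blast
      then have "D u v = D u z + D z v" using dist_through[of z c c' u v] Bc gbr zV by blast
      then show "3 \<le> D u v" using cc g dist_commute[of u z] by simp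
    qed
    have gdom: "D w (g (f w)) \<le> d" if "w \<in> R" "D z w = d" for w
    proof -
      have c: "f w \<in> B" using that by (auto simp: B_def)
      have "D w (g (f w)) \<le> D w (f w) + D (f w) (g (f w))"
        using triangle[of w "f w" "g (f w)"] that c g WV f by (auto simp: R_def)
      then show ?thesis using g[OF c] f[OF that(1)] that(2) dist_commute[of w "f w"]
        by (simp add: branch_def)
    qed
    have domI: "covers d (X \<union> Y) W" if "\<And>w. w \<in> R \<Longrightarrow> \<exists>y\<in>Y. D w y \<le> d" for Y
      unfolding covers_def
    proof
      fix w assume "w \<in> W"
      then show "\<exists>y\<in>X \<union> Y. D w y \<le> d"
        using that[of w] by (cases "w \<in> R") (auto simp: R_def not_less)
    qed
    show ?thesis
    proof (cases "\<exists>y\<in>X. D z y \<le> 1")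
      case True
      then obtain y where y: "y \<in> X" "D z y \<le> 1" by auto
      have far: "D z w = d" if "w \<in> R" for w
      proof -
        have "D w y \<le> D w z + D z y" using triangle[of w z y] that y X UV WV zV by (auto simp: R_def)
        then have "d \<le> D z w" using that y dist_commute[of w z] by (fastforce simp: R_def)
        then show ?thesis using z(2)[of w] that by (simp add: R_def)
      qed
      have "packing (X \<union> g ` B)" using X gg gX by (intro packing_Un) auto
      moreover have "covers d (X \<union> g ` B) W"
        by (rule domI) (use far gdom in \<open>auto simp: B_def\<close>)
      moreover have "d * card (g ` B) \<le> card W - 1"
        using cardB card_image_le[OF finB, of g] by (meson le_trans mult_le_mono2)
      ultimately show ?thesis using g by (intro exI[of _ "g ` B"]) auto
    next
      case False
      show ?thesis
      proof (cases "R = {}")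
        case True
        then have "covers d (X \<union> {}) W" by (intro domI) simp
        then show ?thesis using X by (intro exI[of _ "{}"]) auto
      next
        case False
        \<comment> \<open>If deep branches exist, \<open>c0\<close> is taken from \<open>B\<close>,
          so that it replaces \<open>g c0\<close> and costs nothing extra. If there are none,
          \<open>c0\<close> is paid for by \<open>d < card W\<close>.\<close>
        have "\<exists>w\<in>R. B \<noteq> {} \<longrightarrow> f w \<in> B" using False by (auto simp: B_def)
        then obtain w0 where w0: "w0 \<in> R" "B \<noteq> {} \<Longrightarrow> f w0 \<in> B" by blast
        define c0 where "c0 = f w0"
        have c0: "c0 \<in> V" "D z c0 = 1" "c0 \<noteq> b" "c0 \<in> W"
          using f fb fW w0 by (auto simp: c0_def)
        have c0br: "c0 \<in> branch z c0" using c0 by (simp add: branch_def)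
        let ?Y = "{c0} \<union> g ` (B - {c0})"
        have "3 \<le> D v c0" if v: "v \<in> g ` (B - {c0})" for v
        proof -
          obtain c where c: "c \<in> B" "c \<noteq> c0" "v = g c" using v by auto
          then have "D v c0 = D v z + D z c0"
            using dist_through[of z c c0 v c0] Bc c0 c0br gbr zV by blast
          then show ?thesis using c c0 g dist_commute[of v z] by simp
        qed
        then have packY: "packing ?Y" using gg by (intro packing_Un) (auto simp: packing_def)
        have "3 \<le> D c0 y" if "y \<in> X" for y
          using away[OF c0br c0(1-3) that] \<open>\<not> (\<exists>y\<in>X. D z y \<le> 1)\<close> that c0 dist_commute[of c0 z]
          by fastforce
        then have "packing (X \<union> ?Y)" using gX by (intro packing_Un[OF X(2) packY]) auto
        moreover have "covers d (X \<union> ?Y) W"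
        proof (rule domI)
          fix w assume w: "w \<in> R"
          then have wV: "w \<in> V" "w \<in> W" using WV by (auto simp: R_def)
          consider "D z w < d" | "D z w = d" "f w = c0" | "D z w = d" "f w \<noteq> c0"
            using z(2)[OF wV(2)] by linarith
          then show "\<exists>y\<in>?Y. D w y \<le> d"
          proof cases
            case 1
            then have "D w c0 \<le> d"
              using triangle[of w z c0] wV zV c0 dist_commute[of w z] by simp
            then show ?thesis by blast
          next
            case 2
            then have "w \<in> branch z c0" using f[OF w] by simp
            then have "D w c0 \<le> d" using 2(1) dist_commute[of w c0] by (simp add: branch_def)
            then show ?thesis by blast
          next
            case 3
            then have "f w \<in> B - {c0}" using w by (auto simp: B_def)
            then show ?thesis using gdom[OF w 3(1)] by blast
          qed
        qed
        moreover have "d * card ?Y \<le> card W - 1"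
        proof (cases "B = {}")
          case True
          then show ?thesis using dW by simp
        next
          case False
          then have "c0 \<in> B" using w0 by (simp add: c0_def)
          then have "0 < card B" using finB by (auto simp: card_gt_0_iff)
          have "card ?Y \<le> Suc (card (g ` (B - {c0})))" using finB by (simp add: card_insert_if)
          also have "\<dots> \<le> Suc (card (B - {c0}))" using finB by (simp add: card_image_le)
          also have "\<dots> = card B" using finB \<open>c0 \<in> B\<close> \<open>0 < card B\<close> by simp
          finally show ?thesis using cardB by (meson le_trans mult_le_mono2)
        qed
        moreover have "?Y \<subseteq> W" using c0 g by auto
        ultimately show ?thesis by blast
      qed
    qed
  qed
qed

section \<open>Assembling the cells\<close>

text \<open>Adding cells one by one is phrased through a maximal collection \<open>Q\<close>
  containing \<open>W0\<close>. If its union is not \<open>V\<close>, a boundary edge leads into a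
  further cell, and adding that cell keeps the union convex.\<close>

lemma packing_from_cells:
  assumes d: "2 \<le> d" and P: "\<Union>P = V" "pairwise disjnt P" "\<forall>W\<in>P. cell d W" and W0: "W0 \<in> P"
  shows "\<exists>X\<subseteq>V. packing X \<and> covers d X V \<and> d * card X \<le> d + (\<Sum>W\<in>P - {W0}. card W - 1)"
proof -
  \<comment> \<open>The summand \<open>d\<close> pays for the centre of \<open>W0\<close>, so
    \<open>W0\<close> itself is left out of the sum.\<close>
  define good where "good Q \<longleftrightarrow> Q \<subseteq> P \<and> W0 \<in> Q \<and> dconvex (\<Union>Q) \<and>
    (\<exists>X\<subseteq>\<Union>Q. packing X \<and> covers d X (\<Union>Q) \<and> d * card X \<le> d + (\<Sum>W\<in>Q - {W0}. card W - 1))"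
    for Q
  have finP: "finite P" using P(1) finite_V by (simp add: finite_UnionD)
  obtain z where z: "z \<in> W0" "\<forall>w\<in>W0. D z w \<le> d" and cW0: "dconvex W0"
    using P(3) W0 unfolding cell_def by meson
  have "packing {z} \<and> covers d {z} W0" using z by (auto simp: packing_def covers_def dist_commute)
  then have "good {W0}" unfolding good_def using W0 cW0 z(1)
    by (intro conjI exI[of _ "{z}"]) auto
  moreover have "finite {Q. good Q}"
    by (rule finite_subset[of _ "Pow P"]) (use finP in \<open>auto simp: good_def\<close>)
  ultimately obtain Q where Q: "good Q" and maxQ: "\<And>Q'. good Q' \<Longrightarrow> Q \<subseteq> Q' \<Longrightarrow> Q = Q'"
    using finite_has_maximal[of "{Q. good Q}"] by blast
  have QP: "Q \<subseteq> P" "W0 \<in> Q" and cQ: "dconvex (\<Union>Q)" using Q unfolding good_def by auto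
  obtain X where X: "X \<subseteq> \<Union>Q" "packing X" "covers d X (\<Union>Q)"
    "d * card X \<le> d + (\<Sum>W\<in>Q - {W0}. card W - 1)"
    using Q unfolding good_def by auto
  have "\<Union>Q = V"
  proof (rule ccontr)
    assume "\<Union>Q \<noteq> V"
    then obtain v where v: "v \<in> V - \<Union>Q" using dconvex_subset[OF cQ] by blast
    have "z \<in> \<Union>Q" using z QP by blast
    then obtain a b where ab: "a \<in> \<Union>Q" "b \<in> V - \<Union>Q" "D a b = 1"
      using exists_boundary_edge[OF dconvex_subset[OF cQ] _ v] by blast
    then obtain W where W: "W \<in> P" "b \<in> W" using P(1) by blast
    have WQ: "W \<notin> Q" using W ab by blast
    have cell: "cell d W" using P(3) W by blast
    have "W' \<inter> W = {}" if "W' \<in> Q" for W'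
      using pairwiseD[OF P(2), of W' W] that QP(1) W(1) WQ by (auto simp: disjnt_def)
    then have disj: "\<Union>Q \<inter> W = {}" by blast
    obtain Y where Y: "Y \<subseteq> W" "d * card Y \<le> card W - 1" "packing (X \<union> Y)" "covers d (X \<union> Y) W"
      using extend_by_cell[OF d cQ cell disj X(1,2)] by blast
    have cQW: "dconvex (\<Union>Q \<union> W)"
      using dconvex_Un_adjacent[OF cQ _ disj ab(1) W(2) ab(3)] cell unfolding cell_def by blast
    have "card (X \<union> Y) \<le> card X + card Y" by (rule card_Un_le)
    then have "d * card (X \<union> Y) \<le> d * card X + d * card Y"
      by (metis add_mult_distrib2 mult_le_mono2)
    also have "\<dots> \<le> d + (\<Sum>W\<in>Q - {W0}. card W - 1) + (card W - 1)" using X(4) Y(2) by simp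
    also have "\<dots> = d + (\<Sum>W\<in>insert W Q - {W0}. card W - 1)"
    proof -
      have "finite Q" using QP finP finite_subset by blast
      moreover have "insert W Q - {W0} = insert W (Q - {W0})" using WQ QP by blast
      ultimately show ?thesis using WQ by simp
    qed
    finally have *: "d * card (X \<union> Y) \<le> d + (\<Sum>W\<in>insert W Q - {W0}. card W - 1)" .
    have "covers d (X \<union> Y) (\<Union>Q \<union> W)" using X(3) Y(4) unfolding covers_def by blast
    then have "good (insert W Q)" unfolding good_def
      using QP W(1) cQW Y X(1) * by (intro conjI exI[of _ "X \<union> Y"]) (auto simp: Un_commute)
    then show False using maxQ WQ by blast
  qed
  \<comment> \<open>The sum in the goal ranges over \<open>P\<close>. A cell outside
    \<open>Q\<close> would be nonempty yet disjoint from \<open>V\<close>.\<close>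
  have "Q = P"
  proof (rule ccontr)
    assume "Q \<noteq> P"
    then obtain W where W: "W \<in> P" "W \<notin> Q" using QP by blast
    then obtain w where w: "w \<in> W" using P(3) unfolding cell_def by blast
    then obtain W' where W': "W' \<in> Q" "w \<in> W'" using P(1) \<open>\<Union>Q = V\<close> W by blast
    then show False using pairwiseD[OF P(2), of W' W] W QP(1) w by (auto simp: disjnt_def)
  qed
  then show ?thesis using X \<open>\<Union>Q = V\<close> by blast
qed

lemma exists_small_covering_packing:
  assumes "V \<noteq> {}" and d: "2 \<le> d"
  shows "\<exists>X\<subseteq>V. packing X \<and> covers d X V \<and>
    real d * real (card X) \<le> real (card V) - 2 * sqrt (real (card V)) + real d + 1"
proof (cases "d < card V")
  case False
  obtain z where z: "z \<in> V" using assms by blast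
  have "D v z \<le> d" if "v \<in> V" for v
    using dist_less_card_dconvex[OF dconvex_V that z] False by simp
  then have "covers d {z} V" by (simp add: covers_def)
  \<comment> \<open>With \<open>n = card V\<close> this square is \<open>n - 2 sqrt n + 1\<close>,
    so the right-hand side of the bound is at least \<open>d\<close>.\<close>
  moreover have "0 \<le> (sqrt (real (card V)) - 1)\<^sup>2" by simp
  then have "real d * real (card {z}) \<le> real (card V) - 2 * sqrt (real (card V)) + real d + 1"
    by (simp add: power2_diff)
  ultimately show ?thesis using z by (intro exI[of _ "{z}"]) (auto simp: packing_def)
next
  case True
  then obtain P where P: "\<Union>P = V" "pairwise disjnt P" "\<forall>W\<in>P. cell d W"
    using partition_into_cells[OF dconvex_V] by blast
  have finP: "finite P" using P(1) finite_V by (simp add: finite_UnionD)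
  have finW: "finite W" if "W \<in> P" for W using that P(1) finite_V by (meson Sup_upper finite_subset)
  have neP: "P \<noteq> {}" using P(1) assms by blast
  \<comment> \<open>The cell omitted from the sum is a largest one: this makes \<open>card V\<close>
    at most \<open>card P * w\<close>, and the mean inequality then bounds \<open>card P + w\<close>
    from below.\<close>
  define w where "w = Max (card ` P)"
  have "w \<in> card ` P" unfolding w_def using finP neP by (intro Max_in) auto
  then obtain W0 where W0: "W0 \<in> P" "card W0 = w" by auto
  have le: "card W \<le> w" if "W \<in> P" for W unfolding w_def using that finP by simp
  have cardV: "card V = (\<Sum>W\<in>P. card W)"
    using card_Union_disjoint[of P] P finW by (simp add: pairwise_def)
  have "card V \<le> card P * w" unfolding cardV using sum_bounded_above[of P card w] le by simp
  then have wk: "real (card V) \<le> real (card P) * real w" by (metis of_nat_le_iff of_nat_mult)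
  obtain X where X: "X \<subseteq> V" "packing X" "covers d X V"
    "d * card X \<le> d + (\<Sum>W\<in>P - {W0}. card W - 1)"
    using packing_from_cells[OF d P W0(1)] by blast
  have pos: "1 \<le> card W" if "W \<in> P" for W using P(3) that unfolding cell_def by force
  have "real (\<Sum>W\<in>P - {W0}. card W - 1) = (\<Sum>W\<in>P - {W0}. real (card W) - 1)"
    using pos by (simp add: of_nat_diff)
  also have "\<dots> = (\<Sum>W\<in>P. real (card W) - 1) - (real w - 1)"
    using W0 finP by (simp add: sum_diff1)
  also have "\<dots> = real (card V) - real (card P) - real w + 1"
    using cardV by (simp add: sum_subtractf)
  finally have "real (\<Sum>W\<in>P - {W0}. card W - 1) = real (card V) - real (card P) - real w + 1" .
  moreover have "real (d * card X) \<le> real (d + (\<Sum>W\<in>P - {W0}. card W - 1))"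
    using X(4) by (rule of_nat_mono)
  ultimately have bound:
    "real d * real (card X) \<le> real d + (real (card V) - real (card P) - real w + 1)"
    unfolding of_nat_mult of_nat_add by linarith
  have "sqrt (real (card V)) \<le> sqrt (real (card P) * real w)" using wk by simp
  also have "\<dots> \<le> (real (card P) + real w) / 2" by (rule arith_geo_mean_sqrt) simp_all
  finally show ?thesis using X bound by (intro exI[of _ X]) auto
qed

end

section \<open>The metric of an undirected tree\<close>

text \<open>A \<open>nat\<close>-valued counterpart of the \<open>ereal\<close>-valued
  \<open>graph_dist\<close>. The \<open>LEAST\<close> is meaningful only when a walk exists, which
  connectedness guarantees between vertices.\<close>

definition hop_dist :: "('a, 'b) pre_digraph \<Rightarrow> 'a \<Rightarrow> 'a \<Rightarrow> nat" where
  "hop_dist G u v = (LEAST k. \<exists>p. pre_digraph.awalk G u p v \<and> length p = k)"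

lemma hop_dist_le: "pre_digraph.awalk G u p v \<Longrightarrow> hop_dist G u v \<le> length p"
  unfolding hop_dist_def by (rule Least_le) blast

lemma hop_dist_attained:
  assumes "graph G" "connected G" "u \<in> verts G" "v \<in> verts G"
  shows "\<exists>p. pre_digraph.awalk G u p v \<and> length p = hop_dist G u v"
proof -
  interpret graph G by fact
  have "strongly_connected G"
    using symmetric_connected_imp_strongly_connected assms(2) sym_arcs by blast
  then have "\<exists>k p. awalk u p v \<and> length p = k"
    using assms(3,4) unfolding strongly_connected_def reachable_awalk by blast
  then show ?thesis unfolding hop_dist_def by (rule LeastI_ex)
qed

lemma hop_dist_commute:
  assumes "graph G"
  shows "hop_dist G u v = hop_dist G v u"
proof -
  interpret graph G by fact
  have "sym_digraph G" by unfold_locales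
  then have "(\<exists>p. awalk u p v \<and> length p = k) \<longleftrightarrow> (\<exists>p. awalk v p u \<and> length p = k)" for k
    using awalk_reverse by metis
  then show ?thesis unfolding hop_dist_def by simp
qed

text \<open>Otherwise shortest walks from \<open>c\<close> to \<open>v\<close> and from
  \<open>v\<close> to \<open>c'\<close> both avoid \<open>z\<close>. Shortened to a path from
  \<open>c\<close> to \<open>c'\<close> and closed up through \<open>z\<close>, they give a
  forbidden cycle.\<close>

lemma undirected_tree_no_backtrack:
  assumes T: "undirected_tree T"
    and V: "v \<in> verts T" "z \<in> verts T" "c \<in> verts T" "c' \<in> verts T" and "c \<noteq> c'"
    and zc: "hop_dist T z c = 1" "hop_dist T z c' = 1" and vz: "hop_dist T v z = Suc (hop_dist T v c)"
  shows "\<not> hop_dist T v c' \<le> hop_dist T v z"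
proof
  assume le: "hop_dist T v c' \<le> hop_dist T v z"
  have gT: "graph T" and conn: "connected T"
    and acyc: "\<And>p. pre_digraph.cycle T p \<Longrightarrow> length p < 3"
    using T unfolding undirected_tree_def by (auto simp: not_le)
  interpret graph T by fact
  note attained = hop_dist_attained[OF gT conn] and commute = hop_dist_commute[OF gT]
  obtain p where p: "awalk c p v" "length p = hop_dist T c v" using attained[OF V(3,1)] by blast
  obtain q where q: "awalk v q c'" "length q = hop_dist T v c'" using attained[OF V(1,4)] by blast
  obtain es where "awalk z es c" "length es = 1" using attained[OF V(2,3)] zc by auto
  then obtain e where e: "e \<in> arcs T" "tail T e = z" "head T e = c"
    by (auto simp: length_Suc_conv awalk_simps)
  obtain es' where "awalk c' es' z" "length es' = 1" using attained[OF V(4,2)] zc commute by auto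
  then obtain e' where e': "e' \<in> arcs T" "tail T e' = c'" "head T e' = z"
    by (auto simp: length_Suc_conv awalk_simps)
  have zp: "z \<notin> set (awalk_verts c p)"
  proof
    assume "z \<in> set (awalk_verts c p)"
    then obtain p1 p2 where "p = p1 @ p2" "awalk z p2 v" using awalk_decomp[OF p(1)] by blast
    then have "hop_dist T z v \<le> length p" using hop_dist_le[of T z p2 v] by simp
    then show False using p(2) vz commute[of z v] commute[of c v] by simp
  qed
  \<comment> \<open>A visit to \<open>z\<close> would give \<open>q\<close> length at least
    \<open>hop_dist T v z + 1\<close>, against \<open>le\<close>.\<close>
  have zq: "z \<notin> set (awalk_verts v q)"
  proof
    assume "z \<in> set (awalk_verts v q)"
    then obtain q1 q2 where q12: "q = q1 @ q2" "awalk v q1 z" "awalk z q2 c'"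
      using awalk_decomp[OF q(1)] by blast
    then have "hop_dist T v z \<le> length q1" "hop_dist T z c' \<le> length q2"
      using hop_dist_le[of T v q1 z] hop_dist_le[of T z q2 c'] by simp_all
    then show False using q12(1) q(2) le zc by simp
  qed
  define r where "r = awalk_to_apath (p @ q)"
  have pq: "awalk c (p @ q) c'" using p(1) q(1) by (rule awalk_appendI)
  then have r: "apath c r c'" "set r \<subseteq> set (p @ q)"
    unfolding r_def by (simp_all only: apath_awalk_to_apath awalk_to_apath_subset)
  have rw: "awalk c r c'" and rd: "distinct (awalk_verts c r)" using r(1) by (auto simp: apath_def)
  have "set (awalk_verts c r) \<subseteq> set (awalk_verts c (p @ q))"
    unfolding set_awalk_verts[OF rw] set_awalk_verts[OF pq] using r(2) by auto
  then have zr: "z \<notin> set (awalk_verts c r)"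
    using zp zq unfolding set_awalk_verts_append[OF p(1) q(1)] by blast
  \<comment> \<open>This brings the cycle \<open>e # r @ [e']\<close> to length at least 3 and
    excludes merely going back and forth along one edge.\<close>
  have r_ne: "r \<noteq> []" using rw \<open>c \<noteq> c'\<close> by (auto simp: awalk_simps)
  have e'w: "awalk c' [e'] z" using e' V by (simp add: awalk_simps)
  have rw': "awalk c (r @ [e']) z" using rw e'w by (rule awalk_appendI)
  have "awalk z (e # r @ [e']) z" using rw' e by (simp only: awalk_Cons_iff)
  moreover have "awalk_verts c (r @ [e']) = awalk_verts c r @ [z]"
    using awalk_verts_append[OF rw'] e' by simp
  then have "distinct (tl (awalk_verts z (e # r @ [e'])))" using rd zr e by simp
  ultimately have "cycle (e # r @ [e'])" unfolding cycle_def by blast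
  then have "length (e # r @ [e']) < 3" by (rule acyc)
  then show False using r_ne by (cases r) auto
qed

lemma undirected_tree_metric:
  assumes T: "undirected_tree T"
  shows "tree_metric (verts T) (hop_dist T)"
proof -
  have gT: "graph T" and conn: "connected T" using T unfolding undirected_tree_def by simp_all
  interpret graph T by fact
  note attained = hop_dist_attained[OF gT conn] and commute = hop_dist_commute[OF gT]
  have self: "hop_dist T a a = 0" if "a \<in> verts T" for a
    using hop_dist_le[of T a "[]" a] that by (simp add: awalk_Nil_iff)
  have tri: "hop_dist T a c \<le> hop_dist T a b + hop_dist T b c"
    if "a \<in> verts T" "b \<in> verts T" "c \<in> verts T" for a b c
  proof -
    obtain p q where pq: "awalk a p b" "length p = hop_dist T a b"
      "awalk b q c" "length q = hop_dist T b c"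
      using attained \<open>a \<in> verts T\<close> \<open>b \<in> verts T\<close> \<open>c \<in> verts T\<close> by meson
    then show ?thesis using hop_dist_le[OF awalk_appendI[OF pq(1,3)]] by simp
  qed
  show ?thesis
  proof
    show "finite (verts T)" by simp
    show "hop_dist T a b = 0 \<longleftrightarrow> a = b" if "a \<in> verts T" "b \<in> verts T" for a b
      using attained[OF that] self[OF that(1)] by (auto simp: awalk_Nil_iff)
    show "hop_dist T a b = hop_dist T b a" for a b by (rule commute)
    show "hop_dist T a c \<le> hop_dist T a b + hop_dist T b c"
      if "a \<in> verts T" "b \<in> verts T" "c \<in> verts T" for a b c
      using that by (rule tri)
    show "\<exists>c\<in>verts T. hop_dist T a c = 1 \<and> hop_dist T a b = Suc (hop_dist T c b)"
      if ab: "a \<in> verts T" "b \<in> verts T" "a \<noteq> b" for a b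
    proof -
      obtain p where p: "awalk a p b" "length p = hop_dist T a b" using attained[OF ab(1,2)] by blast
      then obtain e q where q: "p = e # q" using ab(3) by (cases p) (auto simp: awalk_simps)
      then have w: "e \<in> arcs T" "tail T e = a" "awalk (head T e) q b" using p by (auto simp: awalk_simps)
      \<comment> \<open>The first arc of a shortest walk gives upper bounds for both distances; the
        triangle inequality turns them into equalities.\<close>
      let ?c = "head T e"
      have c: "?c \<in> verts T" using w(1) by simp
      have "awalk a [e] ?c" using w by (simp add: awalk_simps)
      then have "hop_dist T a ?c \<le> 1" using hop_dist_le[of T a "[e]" ?c] by simp
      moreover have "hop_dist T ?c b \<le> length q" using w(3) by (rule hop_dist_le)
      moreover have "hop_dist T a b \<le> hop_dist T a ?c + hop_dist T ?c b" using tri ab c by blast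
      ultimately show ?thesis using p(2) q c by (intro bexI[of _ ?c]) auto
    qed
    show "hop_dist T v c' = Suc (hop_dist T v z)"
      if "v \<in> verts T" "z \<in> verts T" "c \<in> verts T" "c' \<in> verts T" "c \<noteq> c'"
        "hop_dist T z c = 1" "hop_dist T z c' = 1" "hop_dist T v z = Suc (hop_dist T v c)"
      for v z c c'
      using undirected_tree_no_backtrack[OF T that] tri[of v z c'] that by simp
  qed
qed

section \<open>From the tree metric back to \<open>gamma2\<close>\<close>

theorem theorem1p5:
  fixes T :: "('a, 'b) pre_digraph" and d n :: nat
  assumes "2 \<le> d"
    and "undirected_tree T"
    and "card (verts T) = n"
  shows "real (gamma2 T d) \<le> (real n - 2 * sqrt (real n) + real d + 1) / real d"
proof -
  have gT: "graph T" and conn: "connected T" using assms(2) unfolding undirected_tree_def by simp_all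
  interpret graph T by fact
  interpret tree_metric "verts T" "hop_dist T" using assms(2) by (rule undirected_tree_metric)
  have wf: "wf_digraph T" by unfold_locales
  have "verts T \<noteq> {}" using conn by (simp add: connected_conv)
  then obtain X where X: "X \<subseteq> verts T" "packing X" "covers d X (verts T)"
    and cardX: "real d * real (card X) \<le> real n - 2 * sqrt (real n) + real d + 1"
    using exists_small_covering_packing[OF _ assms(1)] assms(3) by blast
  have "distance_dominating T d X"
    unfolding distance_dominating_def
  proof (intro conjI ballI X(1))
    fix v assume v: "v \<in> verts T - X"
    then obtain x where x: "x \<in> X" "hop_dist T v x \<le> d" using X(3) unfolding covers_def by blast
    then obtain p where p: "awalk v p x" "length p = hop_dist T v x"
      using hop_dist_attained[OF gT conn] v X(1) by blast
    \<comment> \<open>An upper bound on the infimum needs only one walk, namely one attaining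
      \<open>hop_dist\<close>; the lower bound for the packing uses that no walk is shorter than
      \<open>hop_dist\<close>.\<close>
    have "graph_dist T v x \<le> ereal (real (length p))" using graph_dist_le_walk[OF wf p(1)] .
    also have "\<dots> \<le> ereal (real d)" using p(2) x(2) by simp
    finally show "\<exists>x\<in>X. graph_dist T v x \<le> ereal (real d)" using x(1) by blast
  qed
  moreover have "two_packing T X"
    unfolding two_packing_def
  proof (intro conjI ballI impI X(1))
    fix x y assume "x \<in> X" "y \<in> X" "x \<noteq> y"
    then have "3 \<le> hop_dist T x y" using X(2) unfolding packing_def by blast
    then have "ereal (real 3) \<le> graph_dist T x y"
      using hop_dist_le[of T x _ y] by (intro graph_dist_geI[OF wf]) (meson le_trans)
    then show "3 \<le> graph_dist T x y" by simp
  qed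
  ultimately have "gamma2 T d \<le> card X" unfolding gamma2_def by (intro Least_le) blast
  then have "real d * real (gamma2 T d) \<le> real d * real (card X)" by (simp add: mult_left_mono)
  then have "real d * real (gamma2 T d) \<le> real n - 2 * sqrt (real n) + real d + 1"
    using cardX by linarith
  then show ?thesis using assms(1) by (simp add: field_simps)
qed

end
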